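(* The map $f_0$ is a bijection from the set $\bigcup_{n\in\mathbb N}\mathcal W_n^s$ of branch vertices of the trees $T_n^s$ onto the set $\delta(\Omega_p^+)$ of words $u^{-1}$ of $F_d$ such that $u$ is a (possibly empty) prefix of $\omega$.
   Context: Let $d\ge 3$, $A=\{1,\dots,d\}$, and let $\sigma$ be the substitution (morphism of the free monoid $A^*$) $\sigma(1)=12$, $\sigma(k)=k+1$ for $2\le k\le d-1$, $\sigma(d)=1$; $\sigma$ is also regarded as an automorphism of the free group $F_d$ with basis $A$. Let $\omega=\lim_n\sigma^n(1)\in A^{\mathbb N}$. Let $A_\tau=\{1,\dots,2d-2\}$. Trees have oriented edges $(x,y,i)$ (from $x$ to $y$) coloured by $i\in A_\tau$. The tree substitution $\tau$ replaces each edge as follows, keeping its endpoints: $(x,y,1)\mapsto(x,y,d)$; $(x,y,i)\mapsto(x,y,i-1)$ for $3\le i\le d$ and for $d+2\le i\le 2d-2$; $(x,y,d+1)\mapsto(x,y,1)$; and $(x,y,2)$ is replaced by the $d$ edges $(z,x,d)$, $(z,y,1)$ and $(z,z_h,d+h)$ for $1\le h\le d-2$, where $z,z_1,\dots,z_{d-2}$ are new vertices. $T_0^s$ is the tree with root $x_0$ and edges $(x_0,x_j,j)$, $1\le j\le d$, and $T_n^s=\tau^n(T_0^s)$. $\mathcal V_n^s$ is the vertex set of $T_n^s$ (so $\mathcal V_n^s\subset\mathcal V_{n+1}^s$) and $\mathcal W_n^s$ the set of its branch vertices (vertices of degree $d$; all other vertices have degree $1$). For vertices $x,x'$ of $T_n^s$,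 $\gamma_n(x,x')$ is the word in $(A_\tau\cup\overline{A_\tau})^*$ read along the shortest path from $x$ to $x'$, an edge of colour $i$ contributing $i$ if traversed along its orientation and $\overline i$ otherwise. The morphism $p_*:(A_\tau\cup\overline{A_\tau})^*\to F_d$ is given by $p_*(k)=k$ for $1\le k\le d$, $p_*(d+k)=\sigma^k(1)$ for $1\le k\le d-2$, $p_*(\overline k)=p_*(k)^{-1}$. For $x\in\bigcup_n\mathcal W_n^s$, $f_0(x)=\sigma^k(p_*(\gamma_k(x_0,x)))\in F_d$, where $k$ is any integer such that $x$ is a vertex of $T_k^s$ (the value does not depend on $k$). *)

theory Defs
  imports "HOL-Algebra.Group"
begin

section \<open>Free groups\<close>

text \<open>A signed letter is a pair: \<open>(a, True)\<close> is the letter \<open>a\<close> and \<open>(a, False)\<close> is its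
  formal inverse. The free group is realised on the reduced words.\<close>

type_synonym 'a sword = "('a \<times> bool) list"

fun flip :: "'a \<times> bool \<Rightarrow> 'a \<times> bool" where
  "flip (a, e) = (a, \<not> e)"

fun reduced :: "'a sword \<Rightarrow> bool" where
  "reduced [] = True"
| "reduced [s] = True"
| "reduced (s # t # w) = (t \<noteq> flip s \<and> reduced (t # w))"

definition fg_cons :: "'a \<times> bool \<Rightarrow> 'a sword \<Rightarrow> 'a sword" where
  "fg_cons s w = (if w \<noteq> [] \<and> hd w = flip s then tl w else s # w)"

definition free_group :: "'a set \<Rightarrow> 'a sword monoid" where
  "free_group A = \<lparr>carrier = {w. reduced w \<and> fst ` set w \<subseteq> A},
                   mult = (\<lambda>u v. foldr fg_cons u v),
                   one = []\<rparr>"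

definition pos_word :: "'a list \<Rightarrow> 'a sword" where
  "pos_word w = map (\<lambda>a. (a, True)) w"

text \<open>The morphism from signed words to a group \<open>G\<close> sending each letter \<open>a\<close> to \<open>f a\<close> and its
  formal inverse to the inverse of \<open>f a\<close>. On the reduced words over \<open>A\<close> it is the homomorphism
  from \<open>free_group A\<close> to \<open>G\<close> extending \<open>f\<close>.\<close>

definition word_hom :: "('g, 'm) monoid_scheme \<Rightarrow> ('a \<Rightarrow> 'g) \<Rightarrow> 'a sword \<Rightarrow> 'g" where
  "word_hom G f w =
     foldr (\<lambda>(a, e) g. (if e then f a else inv\<^bsub>G\<^esub> (f a)) \<otimes>\<^bsub>G\<^esub> g) w \<one>\<^bsub>G\<^esub>"

lemma flip_flip [simp]: "flip (flip s) = s"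
  by (cases s) auto

lemma fst_flip [simp]: "fst (flip s) = fst s"
  by (cases s) auto

lemma reduced_Cons:
  "reduced (s # w) \<longleftrightarrow> reduced w \<and> (w = [] \<or> hd w \<noteq> flip s)"
  by (cases w) auto

lemma reduced_fg_cons: "reduced w \<Longrightarrow> reduced (fg_cons s w)"
  by (cases w) (auto simp: fg_cons_def reduced_Cons)

lemma reduced_foldr: "reduced w \<Longrightarrow> reduced (foldr fg_cons u w)"
  by (induction u) (auto simp: reduced_fg_cons)

lemma fg_cons_flip: "reduced w \<Longrightarrow> fg_cons (flip s) (fg_cons s w) = w"
  by (cases w) (auto simp: fg_cons_def reduced_Cons)

lemma fg_cons_flip': "reduced w \<Longrightarrow> fg_cons s (fg_cons (flip s) w) = w"
  using fg_cons_flip[of w "flip s"] by simp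

lemma foldr_fg_cons_assoc:
  "reduced w \<Longrightarrow> foldr fg_cons (foldr fg_cons u v) w = foldr fg_cons u (foldr fg_cons v w)"
proof (induction u)
  case Nil
  then show ?case by simp
next
  case (Cons s u)
  have *: "foldr fg_cons (fg_cons s v') w = fg_cons s (foldr fg_cons v' w)" for v'
  proof (cases "v' \<noteq> [] \<and> hd v' = flip s")
    case True
    then have "fg_cons s v' = tl v'" "v' = flip s # tl v'"
      by (auto simp: fg_cons_def) (metis list.collapse)
    then show ?thesis
      using fg_cons_flip'[OF reduced_foldr[OF Cons.prems], of s "tl v'"]
      by (metis foldr.simps(2) comp_apply)
  next
    case False
    then have "fg_cons s v' = s # v'" by (auto simp: fg_cons_def)
    then show ?thesis by simp
  qed
  show ?case using Cons by (simp add: *)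
qed

lemma foldr_fg_cons_Nil: "reduced w \<Longrightarrow> foldr fg_cons w [] = w"
  by (induction w) (auto simp: reduced_Cons fg_cons_def)

lemma set_foldr_fg_cons: "set (foldr fg_cons u v) \<subseteq> set u \<union> set v"
proof (induction u)
  case (Cons s u)
  have "set (fg_cons s w) \<subseteq> insert s (set w)" for w
    by (cases w) (auto simp: fg_cons_def)
  then show ?case using Cons by fastforce
qed simp

lemma foldr_fg_cons_inverse:
  "reduced w \<Longrightarrow> foldr fg_cons (map flip (rev u)) (foldr fg_cons u w) = w"
  by (induction u arbitrary: w) (auto simp: fg_cons_flip reduced_foldr)

lemma group_free_group: "group (free_group A)"
proof (rule groupI)
  fix x y assume "x \<in> carrier (free_group A)" "y \<in> carrier (free_group A)"
  then show "x \<otimes>\<^bsub>free_group A\<^esub> y \<in> carrier (free_group A)"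
    using set_foldr_fg_cons[of x y] by (force simp: free_group_def reduced_foldr)
next
  fix x assume x: "x \<in> carrier (free_group A)"
  define y where "y = foldr fg_cons (map flip (rev x)) []"
  have "y \<in> carrier (free_group A)"
    using x set_foldr_fg_cons[of "map flip (rev x)" "[]"]
    by (force simp: free_group_def y_def reduced_foldr)
  moreover have "foldr fg_cons y x = []"
    using x foldr_fg_cons_inverse[of "[]" x]
    by (simp add: y_def foldr_fg_cons_assoc free_group_def foldr_fg_cons_Nil)
  ultimately show "\<exists>y\<in>carrier (free_group A). y \<otimes>\<^bsub>free_group A\<^esub> x = \<one>\<^bsub>free_group A\<^esub>"
    by (auto simp: free_group_def)
qed (auto simp: free_group_def foldr_fg_cons_assoc)

section \<open>The substitution and its fixed point\<close>

definition sigma_letter :: "nat \<Rightarrow> nat \<Rightarrow> nat list" where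
  "sigma_letter d k = (if k = 1 then [1, 2] else if k = d then [1] else [k + 1])"

definition sigma_word :: "nat \<Rightarrow> nat list \<Rightarrow> nat list" where
  "sigma_word d w = concat (map (sigma_letter d) w)"

definition Fd :: "nat \<Rightarrow> nat sword monoid" where
  "Fd d = free_group {1..d}"

definition sigma :: "nat \<Rightarrow> nat sword \<Rightarrow> nat sword" where
  "sigma d = word_hom (Fd d) (\<lambda>a. pos_word (sigma_letter d a))"

text \<open>Letters of \<open>\<omega>\<close> are indexed from \<open>0\<close>; the limit is that of finite words, letter by letter.\<close>

definition omega :: "nat \<Rightarrow> nat \<Rightarrow> nat" where
  "omega d i = (THE a. \<forall>\<^sub>F n in sequentially.
     i < length ((sigma_word d ^^ n) [1]) \<and> (sigma_word d ^^ n) [1] ! i = a)"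

definition inv_prefixes :: "nat \<Rightarrow> nat sword set" where
  "inv_prefixes d = {inv\<^bsub>Fd d\<^esub> (pos_word u) | u. \<exists>m. u = map (omega d) [0..<m]}"

section \<open>The tree substitution\<close>

text \<open>The vertices \<open>x\<^sub>j\<close> of the initial tree are \<open>Base j\<close>. The new vertices \<open>z\<close> and \<open>z\<^sub>h\<close> created
  from an edge \<open>(x, y, 2)\<close> are \<open>Mid x y\<close> and \<open>Tip h x y\<close>; they really are new, see
  \<open>new_vertices_fresh\<close> below.\<close>

datatype vertex = Base nat | Mid vertex vertex | Tip nat vertex vertex

type_synonym edge = "vertex \<times> vertex \<times> nat"

definition vertices :: "edge set \<Rightarrow> vertex set" where
  "vertices E = (\<Union>(x, y, i)\<in>E. {x, y})"

definition degree :: "edge set \<Rightarrow> vertex \<Rightarrow> nat" where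
  "degree E v = card {(x, y, i). (x, y, i) \<in> E \<and> (x = v \<or> y = v)}"

fun tau_edge :: "nat \<Rightarrow> edge \<Rightarrow> edge set" where
  "tau_edge d (x, y, i) =
     (if i = 1 then {(x, y, d)}
      else if i = 2 then
        {(Mid x y, x, d), (Mid x y, y, 1)} \<union> {(Mid x y, Tip h x y, d + h) | h. h \<in> {1..d-2}}
      else if i = d + 1 then {(x, y, 1)}
      else {(x, y, i - 1)})"

definition tau :: "nat \<Rightarrow> edge set \<Rightarrow> edge set" where
  "tau d E = (\<Union>e\<in>E. tau_edge d e)"

definition tree0 :: "nat \<Rightarrow> edge set" where
  "tree0 d = {(Base 0, Base j, j) | j. j \<in> {1..d}}"

definition tree :: "nat \<Rightarrow> nat \<Rightarrow> edge set" where
  "tree d n = (tau d ^^ n) (tree0 d)"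

definition tree_vertices :: "nat \<Rightarrow> nat \<Rightarrow> vertex set" where
  "tree_vertices d n = vertices (tree d n)"

definition branch_vertices :: "nat \<Rightarrow> nat \<Rightarrow> vertex set" where
  "branch_vertices d n = {x \<in> tree_vertices d n. degree (tree d n) x = d}"

text \<open>\<open>walk E x w y\<close>: the signed word \<open>w\<close> is read along some walk from \<open>x\<close> to \<open>y\<close> in \<open>E\<close>.\<close>

inductive walk :: "edge set \<Rightarrow> vertex \<Rightarrow> nat sword \<Rightarrow> vertex \<Rightarrow> bool" for E where
  walk_Nil: "x \<in> vertices E \<Longrightarrow> walk E x [] x"
| walk_forward: "(x, y, i) \<in> E \<Longrightarrow> walk E y w z \<Longrightarrow> walk E x ((i, True) # w) z"
| walk_backward: "(y, x, i) \<in> E \<Longrightarrow> walk E y w z \<Longrightarrow> walk E x ((i, False) # w) z"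

definition gamma :: "nat \<Rightarrow> nat \<Rightarrow> vertex \<Rightarrow> vertex \<Rightarrow> nat sword" where
  "gamma d n x y = (ARG_MIN length w. walk (tree d n) x w y)"

section \<open>The map from vertices to the free group\<close>

definition p_star :: "nat \<Rightarrow> nat sword \<Rightarrow> nat sword" where
  "p_star d = word_hom (Fd d)
     (\<lambda>i. if i \<le> d then pos_word [i] else (sigma d ^^ (i - d)) (pos_word [1]))"

text \<open>The value does not depend on which \<open>k\<close> is chosen.\<close>

definition f0 :: "nat \<Rightarrow> vertex \<Rightarrow> nat sword" where
  "f0 d x = (let k = (SOME k. x \<in> tree_vertices d k)
             in (sigma d ^^ k) (p_star d (gamma d k (Base 0) x)))"

section \<open>Freshness of the new vertices\<close>

definition well_named :: "edge set \<Rightarrow> bool" where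
  "well_named E \<longleftrightarrow>
     (\<forall>x y. Mid x y \<in> vertices E \<longrightarrow> x \<in> vertices E \<and> y \<in> vertices E \<and> (\<forall>i. (x, y, i) \<notin> E)) \<and>
     (\<forall>h x y. Tip h x y \<in> vertices E \<longrightarrow> x \<in> vertices E \<and> y \<in> vertices E \<and> (\<forall>i. (x, y, i) \<notin> E)) \<and>
     (\<forall>x y i j. (x, y, i) \<in> E \<longrightarrow> (x, y, j) \<in> E \<longrightarrow> i = j) \<and>
     (\<forall>x y i. (x, y, i) \<in> E \<longrightarrow> x \<noteq> y)"

lemma vertices_edge: "(x, y, i) \<in> E \<Longrightarrow> x \<in> vertices E \<and> y \<in> vertices E"
  by (force simp: vertices_def)

lemma in_tauE:
  assumes "(a, b, j) \<in> tau d E"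
  obtains (old) i where "(a, b, i) \<in> E" "i \<noteq> 2"
      "j = (if i = 1 then d else if i = d + 1 then 1 else i - 1)"
    | (mid) x y where "(x, y, 2) \<in> E" "a = Mid x y"
        "b = x \<and> j = d \<or> b = y \<and> j = 1 \<or> (\<exists>h. b = Tip h x y \<and> j = d + h)"
proof -
  from assms obtain x y i where e: "(x, y, i) \<in> E" "(a, b, j) \<in> tau_edge d (x, y, i)"
    by (auto simp: tau_def simp del: tau_edge.simps)
  show ?thesis
  proof (cases "i = 2")
    case True
    with e mid[of x y] show ?thesis by auto
  next
    case False
    with e have "(a, b, i) \<in> E \<and> j = (if i = 1 then d else if i = d + 1 then 1 else i - 1)"
      by (auto split: if_splits)
    with False old show ?thesis by blast
  qed
qed

lemma vertices_tauE:
  assumes "v \<in> vertices (tau d E)"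
  obtains (old) "v \<in> vertices E"
    | (mid) x y where "(x, y, 2) \<in> E" "v = Mid x y"
    | (tip) h x y where "(x, y, 2) \<in> E" "v = Tip h x y"
proof -
  from assms obtain a b j where e: "(a, b, j) \<in> tau d E" "v = a \<or> v = b"
    by (auto simp: vertices_def)
  from e(1) show ?thesis
    by (cases rule: in_tauE) (use e(2) in \<open>auto intro: old mid tip dest: vertices_edge\<close>)
qed

lemma vertices_tau_mono: "vertices E \<subseteq> vertices (tau d E)"
proof
  fix v assume "v \<in> vertices E"
  then obtain x y i where e: "(x, y, i) \<in> E" "v = x \<or> v = y"
    by (auto simp: vertices_def)
  have "v \<in> vertices (tau_edge d (x, y, i))"
    using e(2) by (auto simp: vertices_def)
  with e(1) show "v \<in> vertices (tau d E)"
    by (fastforce simp: vertices_def tau_def simp del: tau_edge.simps)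
qed

lemma well_namedD:
  assumes "well_named E"
  shows "Mid x y \<in> vertices E \<Longrightarrow> x \<in> vertices E \<and> y \<in> vertices E \<and> (\<forall>i. (x, y, i) \<notin> E)"
    and "Tip h x y \<in> vertices E \<Longrightarrow> x \<in> vertices E \<and> y \<in> vertices E \<and> (\<forall>i. (x, y, i) \<notin> E)"
    and "(x, y, i) \<in> E \<Longrightarrow> (x, y, j) \<in> E \<Longrightarrow> i = j"
    and "(x, y, i) \<in> E \<Longrightarrow> x \<noteq> y"
  using assms unfolding well_named_def by blast+

lemma well_named_fresh:
  assumes "well_named E" "(x, y, i) \<in> E"
  shows "Mid x y \<notin> vertices E" "Tip h x y \<notin> vertices E"
  using well_namedD(1,2)[OF assms(1)] assms(2) by blast+

lemma well_named_tau:
  assumes E: "well_named E"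
  shows "well_named (tau d E)"
proof -
  have no: "(a, b, j) \<notin> tau d E" if "a \<in> vertices E" "\<And>i. i \<noteq> 2 \<Longrightarrow> (a, b, i) \<notin> E" for a b j
  proof
    assume "(a, b, j) \<in> tau d E"
    then show False
      by (cases rule: in_tauE) (use that well_named_fresh[OF E] in auto)
  qed
  have new: "x \<in> vertices E \<and> y \<in> vertices E \<and> (\<forall>i. (x, y, i) \<notin> tau d E)" if "(x, y, 2) \<in> E" for x y
    using no[of x y] that vertices_edge[OF that] well_namedD(3)[OF E that] by blast
  have 1: "x \<in> vertices E \<and> y \<in> vertices E \<and> (\<forall>i. (x, y, i) \<notin> tau d E)"
    if "Mid x y \<in> vertices (tau d E)" for x y
    using that
  proof (cases rule: vertices_tauE)
    case old
    then show ?thesis using no[of x y] well_namedD(1)[OF E old] by blast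
  qed (use new in auto)
  have 2: "x \<in> vertices E \<and> y \<in> vertices E \<and> (\<forall>i. (x, y, i) \<notin> tau d E)"
    if "Tip h x y \<in> vertices (tau d E)" for h x y
    using that
  proof (cases rule: vertices_tauE)
    case old
    then show ?thesis using no[of x y] well_namedD(2)[OF E old] by blast
  qed (use new in auto)
  have 3: "i = j" if i: "(a, b, i) \<in> tau d E" and j: "(a, b, j) \<in> tau d E" for a b i j
    using i
  proof (cases rule: in_tauE)
    case (old i')
    from j show ?thesis
    proof (cases rule: in_tauE)
      case o2: (old j')
      then have "i' = j'" using old well_namedD(3)[OF E] by blast
      then show ?thesis using old o2 by simp
    next
      case (mid x y)
      then show ?thesis using well_named_fresh[OF E mid(1)] vertices_edge[OF old(1)] by simp
    qed
  next
    case (mid x y)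
    have xy: "x \<noteq> y" using well_namedD(4)[OF E mid(1)] .
    have f: "Tip h x y \<noteq> x" "Tip h x y \<noteq> y" for h
      using well_named_fresh(2)[OF E mid(1), of h] vertices_edge[OF mid(1)] by metis+
    from j show ?thesis
    proof (cases rule: in_tauE)
      case (old j')
      then show ?thesis using well_named_fresh[OF E mid(1)] vertices_edge[OF old(1)] mid by simp
    next
      case m2: (mid x' y')
      then show ?thesis using mid xy f by auto
    qed
  qed
  have 4: "a \<noteq> b" if "(a, b, i) \<in> tau d E" for a b i
    using that
  proof (cases rule: in_tauE)
    case (old i')
    then show ?thesis using well_namedD(4)[OF E] by blast
  next
    case (mid x y)
    then show ?thesis using well_named_fresh(1)[OF E mid(1)] vertices_edge[OF mid(1)] by auto
  qed
  show ?thesis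
    unfolding well_named_def using 1 2 3 4 vertices_tau_mono[of E d] by blast
qed

lemma well_named_tree: "well_named (tree d n)"
proof (induction n)
  case 0
  then show ?case by (auto simp: tree_def tree0_def well_named_def vertices_def)
next
  case (Suc n)
  then show ?case using well_named_tau by (simp add: tree_def)
qed

lemma new_vertices_fresh:
  assumes "(x, y, i) \<in> tree d n"
  shows "Mid x y \<notin> tree_vertices d n" "Tip h x y \<notin> tree_vertices d n"
  using well_named_fresh[OF well_named_tree assms] by (auto simp: tree_vertices_def)

end

theory Submission
  imports Defs "HOL-Library.Sublist"
begin

text \<open>The map \<open>f\<^sub>0\<close> is a potential: along an edge of colour \<open>i\<close> of \<open>T\<^sub>n\<close> it is multiplied by
  \<open>\<sigma>\<^sup>n(p(i))\<close>, so the vertex \<open>z\<close> created in \<open>T\<^sub>n\<^sub>+\<^sub>1\<close> on an edge \<open>(x, y, 2)\<close> has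
  \<open>f\<^sub>0(z) = f\<^sub>0(x) \<sigma>\<^sup>n(1)\<inverse>\<close>. Let \<open>p\<^sub>m\<close> be the prefix of \<open>\<omega>\<close> of length \<open>m\<close>. By induction on \<open>n\<close>,
  for every colour \<open>i\<close> the values of \<open>f\<^sub>0\<close> at the sources of the edges of colour \<open>i\<close> of \<open>T\<^sub>n\<close> are
  distinct, and they are the \<open>p\<^sub>m\<inverse>\<close> with \<open>m\<close> in an explicit interval. For \<open>i = 2\<close> the interval
  consists of lengths \<open>r\<close> for which \<open>\<sigma>\<^sup>n(1) p\<^sub>r\<close> is again a prefix of \<open>\<omega>\<close>, and adding \<open>|\<sigma>\<^sup>n(1)|\<close>
  moves it to the interval that follows the lengths already attained in \<open>T\<^sub>n\<close>.\<close>

section \<open>Homomorphisms from free groups\<close>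

lemma carrier_free_group: "carrier (free_group A) = {w. reduced w \<and> fst ` set w \<subseteq> A}"
  and mult_free_group: "u \<otimes>\<^bsub>free_group A\<^esub> v = foldr fg_cons u v"
  and one_free_group: "\<one>\<^bsub>free_group A\<^esub> = []"
  by (simp_all add: free_group_def)

lemma word_hom_Nil [simp]: "word_hom G f [] = \<one>\<^bsub>G\<^esub>"
  by (simp add: word_hom_def)

lemma word_hom_Cons [simp]:
  "word_hom G f ((a, e) # w) = (if e then f a else inv\<^bsub>G\<^esub> (f a)) \<otimes>\<^bsub>G\<^esub> word_hom G f w"
  by (simp add: word_hom_def)

context
  fixes G :: "('g, 'm) monoid_scheme" (structure) and f :: "'a \<Rightarrow> 'g" and A :: "'a set"
  assumes G: "group G" and f: "f \<in> A \<rightarrow> carrier G"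
begin

interpretation group G by (rule G)

lemma word_hom_closed: "fst ` set w \<subseteq> A \<Longrightarrow> word_hom G f w \<in> carrier G"
proof (induction w)
  case (Cons s w)
  then show ?case using f by (cases s) auto
qed simp

text \<open>Cancelling a letter against its formal inverse does not change the value in a
  group.\<close>

lemma word_hom_fg_cons:
  assumes "fst s \<in> A" "fst ` set w \<subseteq> A"
  shows "word_hom G f (fg_cons s w) = word_hom G f (s # w)"
proof (cases "w \<noteq> [] \<and> hd w = flip s")
  case True
  then obtain w' where w: "w = flip s # w'" by (metis list.collapse)
  obtain a e where s: "s = (a, e)" by fastforce
  have a: "f a \<in> carrier G" using assms s f by auto
  have "word_hom G f w' \<in> carrier G" using assms w by (auto intro!: word_hom_closed)
  with a show ?thesis
    by (simp add: w s fg_cons_def m_assoc[symmetric])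
qed (auto simp: fg_cons_def)

lemma word_hom_hom: "word_hom G f \<in> hom (free_group A) G"
proof (rule homI)
  fix u v assume u: "u \<in> carrier (free_group A)" and v: "v \<in> carrier (free_group A)"
  have v': "fst ` set v \<subseteq> A" using v by (simp add: carrier_free_group)
  have "fst ` set u \<subseteq> A" using u by (simp add: carrier_free_group)
  then have "word_hom G f (foldr fg_cons u v) = word_hom G f u \<otimes> word_hom G f v"
  proof (induction u)
    case Nil
    then show ?case using word_hom_closed[OF v'] by simp
  next
    case (Cons s u)
    obtain a e where s: "s = (a, e)" by fastforce
    have a: "f a \<in> carrier G" using Cons s f by auto
    have u: "word_hom G f u \<in> carrier G" using Cons by (auto intro!: word_hom_closed)
    have "fst ` set (foldr fg_cons u v) \<subseteq> A"
      using set_foldr_fg_cons[of u v] Cons.prems v' by fastforce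
    then have "word_hom G f (foldr fg_cons (s # u) v) = word_hom G f (s # foldr fg_cons u v)"
      using Cons.prems by (simp add: word_hom_fg_cons)
    then show ?case
      using Cons a u word_hom_closed[OF v'] by (simp add: s m_assoc)
  qed
  then show "word_hom G f (u \<otimes>\<^bsub>free_group A\<^esub> v) = word_hom G f u \<otimes> word_hom G f v"
    by (simp add: mult_free_group)
qed (auto simp: carrier_free_group word_hom_closed)

end

section \<open>Positive words in the free group\<close>

lemma pos_word_Nil [simp]: "pos_word [] = []"
  and pos_word_Cons [simp]: "pos_word (a # u) = (a, True) # pos_word u"
  by (simp_all add: pos_word_def)

lemma inj_pos_word: "inj pos_word"
  by (auto simp: inj_def pos_word_def dest!: map_injective intro: injI)

lemma reduced_pos_word: "reduced (pos_word u)"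
  by (induction u) (auto simp: reduced_Cons pos_word_def hd_map)

lemma pos_word_carrier: "set u \<subseteq> A \<Longrightarrow> pos_word u \<in> carrier (free_group A)"
  unfolding carrier_free_group using reduced_pos_word by (auto simp: pos_word_def)

lemma pos_word_append: "pos_word u \<otimes>\<^bsub>free_group A\<^esub> pos_word v = pos_word (u @ v)"
proof (induction u)
  case (Cons a u)
  have "fg_cons (a, True) (pos_word w) = pos_word (a # w)" for w
    by (cases w) (auto simp: fg_cons_def)
  with Cons show ?case by (simp add: mult_free_group)
qed (simp add: mult_free_group)

lemma group_Fd: "group (Fd d)"
  by (simp add: Fd_def group_free_group)

section \<open>The fixed point of the substitution\<close>

context
  fixes d :: nat
  assumes d3: "d \<ge> 3"
begin

interpretation Fd: group "Fd d" by (rule group_Fd)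

definition S :: "nat \<Rightarrow> nat list" where
  "S n = (sigma_word d ^^ n) [1]"

lemma sigma_word_append: "sigma_word d (u @ v) = sigma_word d u @ sigma_word d v"
  by (simp add: sigma_word_def)

lemma sigma_word_pow_append:
  "(sigma_word d ^^ n) (u @ v) = (sigma_word d ^^ n) u @ (sigma_word d ^^ n) v"
  by (induction n) (simp_all add: sigma_word_append)

lemma set_sigma_letter: "a \<in> {1..d} \<Longrightarrow> set (sigma_letter d a) \<subseteq> {1..d}"
  using d3 by (auto simp: sigma_letter_def)

lemma set_sigma_word: "set u \<subseteq> {1..d} \<Longrightarrow> set (sigma_word d u) \<subseteq> {1..d}"
  using set_sigma_letter by (fastforce simp: sigma_word_def)

lemma set_S: "set (S n) \<subseteq> {1..d}"
proof (induction n)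
  case 0
  then show ?case using d3 by (simp add: S_def)
next
  case (Suc n)
  then show ?case using set_sigma_word[of "S n"] by (simp add: S_def)
qed

lemma S_0 [simp]: "S 0 = [1]"
  by (simp add: S_def)

lemma sigma_word_pow_2: "k \<le> d - 2 \<Longrightarrow> (sigma_word d ^^ k) [2] = [2 + k]"
  using d3 by (induction k) (auto simp: sigma_word_def sigma_letter_def)

lemma sigma_word_pow_2': "(sigma_word d ^^ (d - 1)) [2] = [1]"
proof -
  have "d - 1 = Suc (d - 2)" using d3 by simp
  then show ?thesis
    using sigma_word_pow_2[of "d - 2"] d3 by (simp add: sigma_word_def sigma_letter_def)
qed

lemma S_Suc: "S (Suc n) = S n @ (sigma_word d ^^ n) [2]"
proof -
  have "S (Suc n) = (sigma_word d ^^ n) (sigma_word d [1])"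
    by (simp add: S_def funpow_swap1)
  also have "sigma_word d [1] = [1] @ [2]"
    by (simp add: sigma_word_def sigma_letter_def)
  finally show ?thesis unfolding sigma_word_pow_append by (simp add: S_def)
qed

text \<open>The letter 2 becomes 1 after \<open>d - 1\<close> steps, so the block appended in
  \<open>S_Suc\<close> is an earlier \<open>S n\<close>.\<close>

lemma S_recurrence: "S (Suc (n + (d - 1))) = S (n + (d - 1)) @ S n"
  using S_Suc[of "n + (d - 1)"] sigma_word_pow_2' by (simp add: funpow_add S_def)

lemma prefix_S: "n \<le> m \<Longrightarrow> prefix (S n) (S m)"
proof (induction rule: dec_induct)
  case (step m)
  then show ?case by (auto simp: S_Suc intro: prefix_order.trans)
qed simp

section \<open>Lengths of the words \<open>S n\<close> and prefixes of \<omega>\<close>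

abbreviation L :: "nat \<Rightarrow> nat" where "L n \<equiv> length (S n)"

lemma L_Suc_small: "n < d - 1 \<Longrightarrow> L (Suc n) = Suc (L n)"
  by (simp add: S_Suc sigma_word_pow_2)

lemma L_recurrence: "L (Suc (n + (d - 1))) = L (n + (d - 1)) + L n"
  unfolding S_recurrence by simp

lemma L_Suc_less: "L n < L (Suc n)"
proof (cases "n < d - 1")
  case False
  have "L k > 0" for k using prefix_length_le[OF prefix_S[of 0 k]] by (simp del: length_greater_0_conv)
  then show ?thesis using L_recurrence[of "n - (d - 1)"] False by simp
qed (simp add: L_Suc_small)

lemma L_gt: "n < L n"
proof (induction n)
  case (Suc n)
  then show ?case using L_Suc_less[of n] by linarith
qed simp

lemma omega_eq_S:
  assumes "i < L n"
  shows "omega d i = S n ! i"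
  unfolding omega_def S_def[symmetric]
proof (rule the_equality)
  have "i < L m \<and> S m ! i = S n ! i" if "n \<le> m" for m
    using prefix_S[OF that] assms by (auto simp: prefix_def nth_append)
  then show *: "\<forall>\<^sub>F m in sequentially. i < L m \<and> S m ! i = S n ! i"
    unfolding eventually_sequentially by blast
  fix a assume "\<forall>\<^sub>F m in sequentially. i < L m \<and> S m ! i = a"
  then have "\<forall>\<^sub>F m in sequentially. a = S n ! i"
    using * by eventually_elim auto
  then show "a = S n ! i" by simp
qed

definition omega_prefix :: "nat \<Rightarrow> nat list" where
  "omega_prefix m = map (omega d) [0..<m]"

lemma omega_prefix_eq_take: "m \<le> L n \<Longrightarrow> omega_prefix m = take m (S n)"
  by (rule nth_equalityI) (auto simp: omega_prefix_def omega_eq_S)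

lemma length_omega_prefix [simp]: "length (omega_prefix m) = m"
  by (simp add: omega_prefix_def)

lemma prefix_S_omega: "prefix u (S n) \<Longrightarrow> u = omega_prefix (length u)"
  using omega_prefix_eq_take[OF prefix_length_le] by (auto simp: prefix_def)

lemma set_omega_prefix: "set (omega_prefix m) \<subseteq> {1..d}"
  using omega_prefix_eq_take[of m m] L_gt[of m] set_S[of m] set_take_subset[of m "S m"] by auto

text \<open>\<open>overlap n\<close> is the longest common prefix of \<open>\<omega>\<close> and of the sequence \<open>\<omega>'\<close> with
  \<open>\<omega> = \<sigma>\<^sup>n(1) \<omega>'\<close>.\<close>

function overlap :: "nat \<Rightarrow> nat list" where
  "overlap n = (if n < d - 1 then [] else S (n - (d - 1)) @ overlap (n - (d - 1)))"
  by auto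
termination by (relation "measure id") (use d3 in auto)

declare overlap.simps [simp del]

lemma overlap_small: "n < d - 1 \<Longrightarrow> overlap n = []"
  by (simp add: overlap.simps)

lemma overlap_add: "k = n + (d - 1) \<Longrightarrow> overlap k = S n @ overlap n"
  by (subst overlap.simps) simp

text \<open>The two claims are proved together: each one at \<open>n\<close> rests on the other one
  at \<open>n - (d - 1)\<close>.\<close>

lemma prefix_overlap: "prefix (overlap n) (S (Suc n)) \<and> prefix (S n @ overlap n) (S (n + 2))"
proof (induction n rule: overlap.induct)
  case (1 n)
  show ?case
  proof (cases "n < d - 1")
    case True
    then show ?thesis using prefix_S[of n "n + 2"] by (simp add: overlap_small)
  next
    case False
    define a where "a = n - (d - 1)"
    have n: "n = a + (d - 1)" using False by (simp add: a_def)
    have IH: "prefix (overlap a) (S (Suc a))" "prefix (S a @ overlap a) (S (a + 2))"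
      using 1 False by (simp_all add: a_def)
    have "prefix (S a @ overlap a) (S (Suc n))"
      using IH(2) prefix_S[of "a + 2" "Suc n"] d3 n by (auto intro: prefix_order.trans)
    \<comment> \<open>Two uses of the recurrence give
      \<open>S (n + 2) = S n @ S a @ S (Suc a)\<close>, and the last block starts with
      \<open>overlap a\<close>.\<close>
    moreover have "S (n + 2) = S (Suc n) @ S (Suc a)"
      using S_recurrence[of "Suc a"] n by simp
    then have "prefix (S n @ S a @ overlap a) (S (n + 2))"
      using IH(1) S_recurrence[of a] n by simp
    ultimately show ?thesis using overlap_add[OF n] by simp
  qed
qed

text \<open>A truncation of \<open>overlap n\<close> is a prefix of \<omega> with or without
  \<open>S n\<close> in front, and a prefix of \<omega> is determined by its length.\<close>

lemma S_append_omega_prefix: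
  assumes "r \<le> length (overlap n)"
  shows "S n @ omega_prefix r = omega_prefix (L n + r)"
proof -
  have "overlap n = omega_prefix (length (overlap n))"
    using prefix_overlap prefix_S_omega by blast
  then have *: "omega_prefix r = take r (overlap n)"
    using assms by (metis omega_prefix_def take_map take_upt add_0)
  then have "prefix (S n @ omega_prefix r) (S n @ overlap n)"
    by (simp add: take_is_prefix)
  then have "prefix (S n @ omega_prefix r) (S (n + 2))"
    using prefix_overlap prefix_order.trans by blast
  from prefix_S_omega[OF this] show ?thesis by simp
qed

text \<open>Up to the index shift by \<open>2 * d\<close>, \<open>bound\<close> counts the branch vertices:
  there are \<open>bound (n + 2 * d)\<close> of them in \<open>tree d n\<close>.\<close>

definition bound :: "nat \<Rightarrow> nat" where
  "bound k = (if k < d + 2 then 0 else Suc (length (overlap (k - (d + 2)))))"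

text \<open>Together with \<open>bound_new_lower\<close>: adding \<open>L n\<close> moves
  \<open>{bound (n + 2)..<bound (n + d + 2)}\<close> to the block of lengths first attained in
  \<open>tree d (Suc n)\<close>. The upper end takes one unfolding of
  \<open>overlap\<close>.\<close>

lemma bound_new_upper: "bound (Suc (n + 2 * d)) = L n + bound (n + d + 2)"
proof -
  have "Suc (n + 2 * d) - (d + 2) = n + (d - 1)" using d3 by simp
  from overlap_add[OF this] show ?thesis using d3 by (simp add: bound_def)
qed

text \<open>For \<open>n = a + d\<close>, two unfoldings of \<open>overlap\<close> produce the
  blocks \<open>S (a + (d - 1))\<close> and \<open>S a\<close>, whose lengths add up to
  \<open>L n\<close>. For \<open>n < d\<close> the interval being moved starts at 0.\<close>

lemma bound_new_lower: "bound (n + 2 * d) = L n + bound (n + 2)"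
proof (cases "n < d")
  case small: True
  show ?thesis
  proof (cases n)
    case 0
    have "2 * d - (d + 2) < d - 1" using d3 by simp
    then show ?thesis using d3 0 by (simp add: bound_def overlap_small)
  next
    case (Suc m)
    \<comment> \<open>Only the block \<open>S m\<close> remains, and the 1 added in
      \<open>bound\<close> turns \<open>L m\<close> into \<open>L n\<close>.\<close>
    have "n + 2 * d - (d + 2) = m + (d - 1)" using d3 Suc by simp
    from overlap_add[OF this] show ?thesis using d3 small Suc
      by (simp add: bound_def overlap_small L_Suc_small)
  qed
next
  case False
  then obtain a where a: "n = a + d" by (metis le_add_diff_inverse2 not_less)
  then have n: "n = Suc (a + (d - 1))" using d3 by simp
  have "n + 2 * d - (d + 2) = a + (d - 1) + (d - 1)" "n + 2 - (d + 2) = a" "\<not> n + 2 < d + 2"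
    using d3 n by simp_all
  then show ?thesis
    using overlap_add[of _ "a + (d - 1)"] overlap_add[of _ a] L_recurrence[of a] d3
    by (simp add: bound_def a del: One_nat_def)
qed

text \<open>The increment of \<open>bound\<close> at \<open>n + 2 * d\<close> is
  \<open>bound (n + d + 2) - bound (n + 2)\<close>, whose arguments are at most
  \<open>n + 2 * d\<close>. Below \<open>2 * d\<close> the only jump is from 0 to 1, at
  \<open>d + 2\<close>.\<close>

lemma bound_Suc: "bound k \<le> bound (Suc k)"
proof (induction k rule: less_induct)
  case (less k)
  show ?case
  proof (cases "k < 2 * d")
    case True
    have "overlap (k - (d + 2)) = []" using True d3 by (intro overlap_small) linarith
    then show ?thesis using True by (simp add: bound_def)
  next
    case False
    define n where "n = k - 2 * d"
    have k: "k = n + 2 * d" using False by (simp add: n_def)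
    have "bound j \<le> bound (j + i)" if "j + i \<le> k" for i j
      using that
    proof (induction i)
      case (Suc i)
      then show ?case using less[of "j + i"] by simp
    qed simp
    from this[of "n + 2" d] show ?thesis
      unfolding k bound_new_upper unfolding bound_new_lower using d3 k by (simp add: add_ac)
  qed
qed

lemma bound_mono: "j \<le> k \<Longrightarrow> bound j \<le> bound k"
  by (rule lift_Suc_mono_le[of bound]) (simp_all add: bound_Suc)

lemma bound_2d: "bound (2 * d) = 1"
  using bound_new_lower[of 0] d3 by (simp add: bound_def)

lemma bound_gt: "n < bound (n + 2 * d)"
  using bound_new_lower[of n] L_gt[of n] by simp

section \<open>The potential of a vertex\<close>

lemma pos_word_Fd: "set u \<subseteq> {1..d} \<Longrightarrow> pos_word u \<in> carrier (Fd d)"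
  by (simp add: Fd_def pos_word_carrier)

lemma sigma_hom: "sigma d \<in> hom (Fd d) (Fd d)"
  unfolding sigma_def
  by (subst (2) Fd_def, rule word_hom_hom[OF group_Fd], rule Pi_I, rule pos_word_Fd, rule set_sigma_letter)

lemma sigma_pow_hom: "sigma d ^^ n \<in> hom (Fd d) (Fd d)"
proof (induction n)
  case 0
  then show ?case by (simp add: hom_def)
next
  case (Suc n)
  then show ?case using hom_compose[OF Suc sigma_hom] by (simp add: comp_def)
qed

interpretation sigma_pow: group_hom "Fd d" "Fd d" "sigma d ^^ n" for n
  by unfold_locales (rule sigma_pow_hom)

lemma sigma_pos_word:
  "set u \<subseteq> {1..d} \<Longrightarrow> sigma d (pos_word u) = pos_word (sigma_word d u)"
proof (induction u)
  case Nil
  then show ?case by (simp add: sigma_def sigma_word_def Fd_def one_free_group)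
next
  case (Cons a u)
  then show ?case
    by (simp add: sigma_def sigma_word_def) (simp add: Fd_def pos_word_append)
qed

lemma sigma_pow_1: "(sigma d ^^ n) (pos_word [1]) = pos_word (S n)"
proof (induction n)
  case (Suc n)
  then show ?case using sigma_pos_word[OF set_S[of n]] by (simp add: S_def)
qed simp

section \<open>Group elements carried by the colours\<close>

definition colour :: "nat \<Rightarrow> nat sword" where
  "colour i = (if i \<le> d then pos_word [i] else (sigma d ^^ (i - d)) (pos_word [1]))"

lemma p_star_eq: "p_star d = word_hom (Fd d) colour"
  unfolding p_star_def colour_def ..

lemma colour_closed: "i \<ge> 1 \<Longrightarrow> colour i \<in> carrier (Fd d)"
  unfolding colour_def using pos_word_Fd[OF set_S] pos_word_Fd[of "[i]"]
  by (auto simp: sigma_pow_1[simplified])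

text \<open>\<open>sigma\<close> undoes the recolouring of \<open>tau\<close>, so an edge that is
  merely recoloured keeps its group element \<sigma>^n(p(i)) at the next level.\<close>

lemma sigma_colour:
  assumes "i \<ge> 1" "i \<noteq> 2"
  shows "sigma d (colour (if i = 1 then d else if i = d + 1 then 1 else i - 1)) = colour i"
proof -
  consider "i = 1" | "3 \<le> i" "i \<le> d" | "i = d + 1" | "i > d + 1" using assms by linarith
  then show ?thesis
  proof cases
    case 1
    then show ?thesis using d3 sigma_pos_word[of "[d]"]
      by (simp add: colour_def sigma_word_def sigma_letter_def)
  next
    case 2
    then obtain k where "i = Suc k" "2 \<le> k" "k < d" by (cases i) auto
    then show ?thesis using sigma_pos_word[of "[k]"]
      by (simp add: colour_def sigma_word_def sigma_letter_def)
  next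
    case 3
    then show ?thesis using d3 by (simp add: colour_def)
  next
    case 4
    define k where "k = i - d - 2"
    have "i = d + Suc (Suc k)" using 4 by (simp add: k_def)
    then show ?thesis using d3 by (simp add: colour_def)
  qed
qed

text \<open>The name \<open>Mid x y\<close> does not record the level of its creation; this recovers
  it.\<close>

definition birth :: "vertex \<Rightarrow> vertex \<Rightarrow> nat" where
  "birth x y = (SOME n. (x, y, 2) \<in> tree d n)"

text \<open>Recursion on vertex names gives a value independent of the tree considered. With n =
  \<open>birth x y\<close>, the factors come from \<sigma>^(n+1)(d) = \<sigma>^n(1) on the edge from
  the new vertex to \<open>x\<close>, and from \<sigma>^(n+1+h)(1) on the edge to tip
  \<open>h\<close>.\<close>

primrec potential :: "vertex \<Rightarrow> nat sword" where
  "potential (Base j) = (if j = 0 then \<one>\<^bsub>Fd d\<^esub> else pos_word [j])"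
| "potential (Mid x y) = potential x \<otimes>\<^bsub>Fd d\<^esub> inv\<^bsub>Fd d\<^esub> pos_word (S (birth x y))"
| "potential (Tip h x y) =
     potential x \<otimes>\<^bsub>Fd d\<^esub> inv\<^bsub>Fd d\<^esub> pos_word (S (birth x y)) \<otimes>\<^bsub>Fd d\<^esub>
     pos_word (S (Suc (birth x y) + h))"

section \<open>Edges of the iterated trees\<close>

lemma tree_0: "tree d 0 = tree0 d" and tree_Suc: "tree d (Suc n) = tau d (tree d n)"
  by (simp_all add: tree_def)

lemma tree_vertices_mono: "n \<le> m \<Longrightarrow> tree_vertices d n \<subseteq> tree_vertices d m"
  by (rule lift_Suc_mono_le[of "tree_vertices d"])
     (simp_all add: tree_vertices_def tree_Suc vertices_tau_mono)

text \<open>Unlike \<open>in_tauE\<close>, an equivalence with \<open>h\<close> bounded, so that new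
  edges can be produced and counted.\<close>

lemma mem_tau:
  "(a, b, j) \<in> tau d E \<longleftrightarrow>
     (\<exists>i. (a, b, i) \<in> E \<and> i \<noteq> 2 \<and> j = (if i = 1 then d else if i = d + 1 then 1 else i - 1)) \<or>
     (\<exists>x y. (x, y, 2) \<in> E \<and> a = Mid x y \<and>
       (b = x \<and> j = d \<or> b = y \<and> j = 1 \<or> (\<exists>h\<in>{1..d-2}. b = Tip h x y \<and> j = d + h)))"
  (is "?l \<longleftrightarrow> ?r")
proof
  assume ?l
  then obtain x y i where e: "(x, y, i) \<in> E" "(a, b, j) \<in> tau_edge d (x, y, i)"
    by (auto simp: tau_def simp del: tau_edge.simps)
  then show ?r by (cases "i = 2") (auto split: if_splits)
next
  assume ?r
  then show ?l
  proof (elim disjE exE)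
    fix i assume "(a, b, i) \<in> E \<and> i \<noteq> 2 \<and> j = (if i = 1 then d else if i = d + 1 then 1 else i - 1)"
    then show ?l unfolding tau_def by (intro UN_I[of "(a, b, i)"]) auto
  next
    fix x y assume "(x, y, 2) \<in> E \<and> a = Mid x y \<and>
      (b = x \<and> j = d \<or> b = y \<and> j = 1 \<or> (\<exists>h\<in>{1..d-2}. b = Tip h x y \<and> j = d + h))"
    then show ?l unfolding tau_def by (intro UN_I[of "(x, y, 2)"]) auto
  qed
qed

lemma mem_tauE:
  assumes "(a, b, j) \<in> tau d E"
  obtains (old) i where "(a, b, i) \<in> E" "i \<noteq> 2"
      "j = (if i = 1 then d else if i = d + 1 then 1 else i - 1)"
    | (mid) x y where "(x, y, 2) \<in> E" "a = Mid x y"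
      "b = x \<and> j = d \<or> b = y \<and> j = 1 \<or> (\<exists>h\<in>{1..d-2}. b = Tip h x y \<and> j = d + h)"
  using assms unfolding mem_tau by blast

text \<open>Once the edge is subdivided, \<open>Mid x y\<close> stays a vertex for good; being fresh
  whenever an edge joins \<open>x\<close> to \<open>y\<close>, it excludes a second
  occurrence.\<close>

lemma birth_eq:
  assumes "(x, y, 2) \<in> tree d n"
  shows "birth x y = n"
proof -
  have *: False if "(x, y, 2) \<in> tree d k" "(x, y, 2) \<in> tree d m" "k < m" for k m
  proof -
    have "(Mid x y, x, d) \<in> tree d (Suc k)"
      using that(1) by (auto simp: tree_Suc mem_tau)
    then have "Mid x y \<in> tree_vertices d (Suc k)"
      unfolding tree_vertices_def by (blast dest: vertices_edge)
    then have "Mid x y \<in> tree_vertices d m"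
      using tree_vertices_mono[of "Suc k" m] that(3) by auto
    then show False using new_vertices_fresh(1)[OF that(2)] by simp
  qed
  show ?thesis unfolding birth_def
  proof (rule some_equality)
    fix m assume "(x, y, 2) \<in> tree d m"
    then show "m = n" using * assms by (meson linorder_neqE_nat)
  qed (rule assms)
qed

lemma colour_ge_1: "(x, y, i) \<in> tree d n \<Longrightarrow> i \<ge> 1"
proof (induction n arbitrary: x y i)
  case 0
  then show ?case by (auto simp: tree_0 tree0_def)
next
  case (Suc n)
  then show ?case using d3 unfolding tree_Suc mem_tau by (fastforce split: if_splits)
qed

lemma potential_closed: "x \<in> tree_vertices d n \<Longrightarrow> potential x \<in> carrier (Fd d)"
proof (induction n arbitrary: x)
  case 0
  then show ?case
    by (auto simp: tree_vertices_def tree_0 tree0_def vertices_def simp del: pos_word_Cons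
      intro!: pos_word_Fd)
next
  case (Suc n)
  from Suc.prems have "x \<in> vertices (tau d (tree d n))" by (simp add: tree_vertices_def tree_Suc)
  then show ?case
  proof (cases rule: vertices_tauE)
    case old
    then show ?thesis using Suc.IH by (simp add: tree_vertices_def)
  next
    case (mid a b)
    then have "potential a \<in> carrier (Fd d)"
      using Suc.IH vertices_edge by (auto simp: tree_vertices_def)
    then show ?thesis using mid pos_word_Fd[OF set_S] by simp
  next
    case (tip h a b)
    then have "potential a \<in> carrier (Fd d)"
      using Suc.IH vertices_edge by (auto simp: tree_vertices_def)
    then show ?thesis using tip pos_word_Fd[OF set_S] by simp
  qed
qed

lemma potential_edge_closed:
  "(x, y, i) \<in> tree d n \<Longrightarrow> potential x \<in> carrier (Fd d) \<and> potential y \<in> carrier (Fd d)"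
  using potential_closed by (auto simp: tree_vertices_def dest: vertices_edge)

lemma potential_edge:
  "(x, y, i) \<in> tree d n \<Longrightarrow> potential y = potential x \<otimes>\<^bsub>Fd d\<^esub> (sigma d ^^ n) (colour i)"
proof (induction n arbitrary: x y i)
  case 0
  then show ?case
    using colour_closed[of i] by (auto simp: tree_0 tree0_def colour_def)
next
  case (Suc n)
  from Suc.prems[unfolded tree_Suc] show ?case
  proof (cases rule: mem_tauE)
    case k: (old k)
    have "sigma d (colour i) = colour k"
      using sigma_colour[of k] k colour_ge_1[OF k(1)] by simp
    then show ?thesis using Suc.IH[OF k(1)] by (simp add: funpow_swap1)
  next
    case ab: (mid a b)
    note cl = potential_edge_closed[OF ab(1)] pos_word_Fd[OF set_S]
    note Fd.m_assoc[simp]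
    have x: "potential x = potential a \<otimes>\<^bsub>Fd d\<^esub> inv\<^bsub>Fd d\<^esub> pos_word (S n)"
      using ab by (simp add: birth_eq)
    have 1: "(sigma d ^^ Suc n) (colour d) = pos_word (S n)"
      using sigma_colour[of 1] d3 sigma_pow_1[of n] by (simp add: funpow_swap1 colour_def)
    have 2: "(sigma d ^^ n) (colour 2) \<in> carrier (Fd d)"
      using colour_closed[of 2] by simp
    \<comment> \<open>By \<sigma>(1) = 12 the two halves of the subdivided edge fit: they carry
      \<sigma>^n(1) towards \<open>a\<close> and \<sigma>^n(1)\<sigma>^n(2) towards
      \<open>b\<close>.\<close>
    have "sigma d (colour 1) = colour 1 \<otimes>\<^bsub>Fd d\<^esub> colour 2"
      using sigma_pos_word[of "[1]"] pos_word_append[of "{1..d}" "[1]" "[2]"] d3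
      by (simp add: colour_def sigma_word_def sigma_letter_def Fd_def)
    then have "(sigma d ^^ Suc n) (colour 1) =
        (sigma d ^^ n) (colour 1) \<otimes>\<^bsub>Fd d\<^esub> (sigma d ^^ n) (colour 2)"
      using colour_closed[of 1] colour_closed[of 2] by (simp add: funpow_swap1)
    moreover have "(sigma d ^^ n) (colour 1) = pos_word (S n)"
      using sigma_pow_1[of n] d3 by (simp add: colour_def)
    ultimately have 3: "(sigma d ^^ Suc n) (colour 1) =
        pos_word (S n) \<otimes>\<^bsub>Fd d\<^esub> (sigma d ^^ n) (colour 2)" by simp
    from ab(3) show ?thesis
    proof (elim disjE bexE conjE)
      assume "y = a" "i = d"
      then show ?thesis using x 1 cl by (simp del: funpow.simps)
    next
      assume "y = b" "i = 1"
      then show ?thesis using x 3 cl 2 Suc.IH[OF ab(1)]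
        by (simp add: Fd.inv_solve_left' del: funpow.simps)
           (simp add: Fd.m_assoc[symmetric] del: Fd.m_assoc funpow.simps)
    next
      fix h assume "h \<in> {1..d - 2}" "y = Tip h a b" "i = d + h"
      moreover from this have "(sigma d ^^ Suc n) (colour i) = pos_word (S (Suc n + h))"
        using sigma_pow_1[of "Suc n + h"] unfolding funpow_add by (simp add: colour_def)
      ultimately show ?thesis using x ab by (simp add: birth_eq del: funpow.simps Fd.m_assoc)
    qed
  qed
qed

section \<open>Walks and the value of \<open>f0\<close>\<close>

lemma walk_closed:
  "walk (tree d n) x w y \<Longrightarrow> potential x \<in> carrier (Fd d) \<and> p_star d w \<in> carrier (Fd d)"
proof (induction rule: walk.induct)
  case (walk_Nil x)
  then show ?case using potential_closed by (simp add: tree_vertices_def p_star_eq)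
next
  case (walk_forward x y i w z)
  then show ?case
    using potential_edge_closed[OF walk_forward(1)] colour_closed[OF colour_ge_1]
    by (auto simp: p_star_eq)
next
  case (walk_backward y x i w z)
  then show ?case
    using potential_edge_closed[OF walk_backward(1)] colour_closed[OF colour_ge_1]
    by (auto simp: p_star_eq)
qed

text \<open>The increments multiply along the walk, so all walks between two vertices, shortest or
  not, yield the same element.\<close>

lemma potential_walk:
  "walk (tree d n) x w y \<Longrightarrow> potential y = potential x \<otimes>\<^bsub>Fd d\<^esub> (sigma d ^^ n) (p_star d w)"
proof (induction rule: walk.induct)
  case (walk_Nil x)
  then show ?case using potential_closed by (simp add: tree_vertices_def p_star_eq)
next
  case (walk_forward x y i w z)
  then show ?case
    using potential_edge_closed[OF walk_forward(1)] colour_closed[OF colour_ge_1[OF walk_forward(1)]]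
      potential_edge[OF walk_forward(1)] walk_closed[OF walk_forward(2)]
    by (simp add: p_star_eq Fd.m_assoc)
next
  case (walk_backward y x i w z)
  note c = potential_edge_closed[OF walk_backward(1)]
    colour_closed[OF colour_ge_1[OF walk_backward(1)]] walk_closed[OF walk_backward(2)]
  have "potential y = potential x \<otimes>\<^bsub>Fd d\<^esub> inv\<^bsub>Fd d\<^esub> (sigma d ^^ n) (colour i)"
    using potential_edge[OF walk_backward(1)] c by (simp add: Fd.m_assoc)
  then show ?case using walk_backward c by (simp add: p_star_eq Fd.m_assoc)
qed

lemma walk_snoc:
  assumes "walk E x w y"
  shows "(y, z, i) \<in> E \<Longrightarrow> \<exists>w. walk E x w z" "(z, y, i) \<in> E \<Longrightarrow> \<exists>w. walk E x w z"
  using assms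
  by (induction rule: walk.induct) (blast intro: walk.intros dest: vertices_edge)+

text \<open>A step along an edge of colour 2 becomes a detour through its midpoint.\<close>

lemma walk_tau: "walk E x w y \<Longrightarrow> \<exists>w. walk (tau d E) x w y"
proof (induction rule: walk.induct)
  case (walk_Nil x)
  then show ?case using vertices_tau_mono[of E d] by (blast intro: walk.intros)
next
  case (walk_forward x y i w z)
  show ?case
  proof (cases "i = 2")
    case True
    then have "(Mid x y, x, d) \<in> tau d E" "(Mid x y, y, 1) \<in> tau d E"
      using walk_forward(1) unfolding mem_tau by blast+
    then show ?thesis using walk_forward.IH by (blast intro: walk.intros)
  next
    case False
    then have "\<exists>j. (x, y, j) \<in> tau d E" using walk_forward(1) unfolding mem_tau by blast
    then show ?thesis using walk_forward.IH by (blast intro: walk.intros)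
  qed
next
  case (walk_backward y x i w z)
  show ?case
  proof (cases "i = 2")
    case True
    then have "(Mid y x, y, d) \<in> tau d E" "(Mid y x, x, 1) \<in> tau d E"
      using walk_backward(1) unfolding mem_tau by blast+
    then show ?thesis using walk_backward.IH by (blast intro: walk.intros)
  next
    case False
    then have "\<exists>j. (y, x, j) \<in> tau d E" using walk_backward(1) unfolding mem_tau by blast
    then show ?thesis using walk_backward.IH by (blast intro: walk.intros)
  qed
qed

lemma tree_connected: "x \<in> tree_vertices d n \<Longrightarrow> \<exists>w. walk (tree d n) (Base 0) w x"
proof (induction n arbitrary: x)
  case 0
  then obtain j where j: "j \<in> {1..d}" "x = Base 0 \<or> x = Base j"
    by (auto simp: tree_vertices_def tree_0 tree0_def vertices_def)
  then have e: "(Base 0, Base j, j) \<in> tree d 0" by (auto simp: tree_0 tree0_def)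
  then have "walk (tree d 0) (Base 0) [] (Base 0)"
    by (blast intro: walk_Nil dest: vertices_edge)
  with walk_snoc(1)[OF this e] j(2) show ?case by blast
next
  case (Suc n)
  have old: "\<exists>w. walk (tree d (Suc n)) (Base 0) w a" if "a \<in> vertices (tree d n)" for a
    using Suc.IH[of a] that walk_tau by (auto simp: tree_vertices_def tree_Suc)
  have mid: "\<exists>w. walk (tree d (Suc n)) (Base 0) w (Mid a b)" if "(a, b, 2) \<in> tree d n" for a b
  proof -
    have "(Mid a b, a, d) \<in> tree d (Suc n)" using that by (auto simp: tree_Suc mem_tau)
    with old[of a] vertices_edge[OF that] show ?thesis by (blast dest: walk_snoc(2))
  qed
  from Suc.prems obtain a b i where e: "(a, b, i) \<in> tree d (Suc n)" "x = a \<or> x = b"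
    by (auto simp: tree_vertices_def vertices_def)
  have "\<exists>w. walk (tree d (Suc n)) (Base 0) w a"
    using e(1)[unfolded tree_Suc] by (cases rule: mem_tauE) (use old mid vertices_edge in auto)
  then show ?case using e by (blast dest: walk_snoc(1))
qed

lemma f0_eq_potential:
  assumes "x \<in> tree_vertices d n"
  shows "f0 d x = potential x"
proof -
  define k where "k = (SOME k. x \<in> tree_vertices d k)"
  have k: "x \<in> tree_vertices d k" unfolding k_def using assms by (rule someI)
  \<comment> \<open>Connectedness makes \<open>ARG_MIN\<close> return an actual walk instead of an
    arbitrary word.\<close>
  from tree_connected[OF k] have *: "walk (tree d k) (Base 0) (gamma d k (Base 0) x) x"
    unfolding gamma_def by (metis arg_min_nat_lemma)
  have "(sigma d ^^ k) (p_star d (gamma d k (Base 0) x)) \<in> carrier (Fd d)"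
    using walk_closed[OF *] by simp
  then show ?thesis using potential_walk[OF *] by (simp add: f0_def Let_def k_def)
qed

section \<open>Edges of a given colour\<close>

definition inv_prefix :: "nat \<Rightarrow> nat sword" where
  "inv_prefix m = inv\<^bsub>Fd d\<^esub> (pos_word (omega_prefix m))"

lemma inj_inv_prefix: "inj inv_prefix"
proof (rule injI)
  fix l m assume "inv_prefix l = inv_prefix m"
  then have "pos_word (omega_prefix l) = pos_word (omega_prefix m)"
    unfolding inv_prefix_def using pos_word_Fd[OF set_omega_prefix] by (metis Fd.inv_inv)
  then have "omega_prefix l = omega_prefix m" using inj_pos_word by (rule injD[rotated])
  then show "l = m" by (metis length_omega_prefix)
qed

lemma range_inv_prefix: "range inv_prefix = inv_prefixes d"
  by (auto simp: inv_prefixes_def inv_prefix_def omega_prefix_def)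

lemma inv_prefix_0: "inv_prefix 0 = \<one>\<^bsub>Fd d\<^esub>"
  using Fd.inv_one by (simp add: inv_prefix_def omega_prefix_def Fd_def one_free_group)

text \<open>The hypothesis says exactly \<open>r \<le> length (overlap n)\<close>, so putting
  \<open>S n\<close> in front of the prefix of length \<open>r\<close> gives a prefix of \<omega>
  again.\<close>

lemma inv_prefix_add:
  assumes "r < bound (n + d + 2)"
  shows "inv_prefix r \<otimes>\<^bsub>Fd d\<^esub> inv\<^bsub>Fd d\<^esub> pos_word (S n) = inv_prefix (L n + r)"
proof -
  have "r \<le> length (overlap n)" using assms by (simp add: bound_def)
  then have "pos_word (omega_prefix (L n + r)) = pos_word (S n) \<otimes>\<^bsub>Fd d\<^esub> pos_word (omega_prefix r)"
    by (simp add: S_append_omega_prefix[symmetric] Fd_def pos_word_append)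
  then show ?thesis
    using pos_word_Fd[OF set_S] pos_word_Fd[OF set_omega_prefix]
    by (simp add: inv_prefix_def Fd.inv_mult_group)
qed

section \<open>Sources of the edges of each colour\<close>

definition edges :: "nat \<Rightarrow> nat \<Rightarrow> (vertex \<times> vertex) set" where
  "edges n i = {(x, y). (x, y, i) \<in> tree d n}"

text \<open>Recolouring \<open>i\<close> to \<open>i - 1\<close> while \<open>n\<close> grows by 1
  preserves \<open>n + i\<close>, hence these ends. Colour 1 becomes \<open>d\<close> at the next
  level and so shares its lower end. Colours above \<open>2 * d - 2\<close> get empty
  intervals.\<close>

definition interval :: "nat \<Rightarrow> nat \<Rightarrow> nat set" where
  "interval n i =
     (if 2 \<le> i \<and> i \<le> d then {bound (n + i)..<bound (n + d + i)}
      else {bound (n + 1 + (if i = 1 then d else i))..<bound (n + 2 * d)})"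

abbreviation source :: "vertex \<times> vertex \<Rightarrow> nat sword" where
  "source \<equiv> \<lambda>e. potential (fst e)"

abbreviation new_interval :: "nat \<Rightarrow> nat set" where
  "new_interval n \<equiv> {bound (n + 2 * d)..<bound (Suc (n + 2 * d))}"

text \<open>Right multiplication by \<sigma>^n(1)^(-1) takes the source of an edge of colour 2 to
  its midpoint; on inverse prefixes it adds \<open>L n\<close> to the length.\<close>

lemma bij_new_vertices:
  assumes "bij_betw source (edges n 2) (inv_prefix ` interval n 2)"
  shows "bij_betw (\<lambda>(x, y). potential (Mid x y)) (edges n 2) (inv_prefix ` new_interval n)"
proof -
  define shift where "shift g = g \<otimes>\<^bsub>Fd d\<^esub> inv\<^bsub>Fd d\<^esub> pos_word (S n)" for g
  have I: "interval n 2 = {bound (n + 2)..<bound (n + d + 2)}"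
    using d3 by (simp add: interval_def)
  have eq: "shift (inv_prefix r) = inv_prefix (L n + r)" if "r \<in> interval n 2" for r
    using that inv_prefix_add[of r n] unfolding I shift_def by simp
  have "shift ` inv_prefix ` interval n 2 = inv_prefix ` (+) (L n) ` interval n 2"
    using eq by (auto simp: image_image intro!: image_cong)
  also have "(+) (L n) ` interval n 2 = new_interval n"
    unfolding I image_add_atLeastLessThan bound_new_upper bound_new_lower by (simp only: add.commute)
  finally have "shift ` inv_prefix ` interval n 2 = inv_prefix ` new_interval n" .
  moreover have "inj_on shift (inv_prefix ` interval n 2)"
    by (rule inj_onI) (auto simp: eq dest!: injD[OF inj_inv_prefix])
  ultimately have "bij_betw shift (inv_prefix ` interval n 2) (inv_prefix ` new_interval n)"
    by (simp add: bij_betw_def)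
  from bij_betw_trans[OF assms this] show ?thesis
    by (rule bij_betw_cong[THEN iffD1, rotated])
       (auto simp: edges_def shift_def birth_eq)
qed

text \<open>With the target \<open>t\<close> arbitrary, one statement serves the new edges towards
  \<open>x\<close>, \<open>y\<close> and every tip.\<close>

lemma bij_new_edges:
  assumes "bij_betw source (edges n 2) (inv_prefix ` interval n 2)"
  shows "bij_betw source ((\<lambda>(x, y). (Mid x y, t x y)) ` edges n 2) (inv_prefix ` new_interval n)"
proof -
  define g where "g = (\<lambda>(x, y). (Mid x y, t x y))"
  have "bij_betw (source \<circ> g) (edges n 2) (inv_prefix ` new_interval n)"
    using bij_new_vertices[OF assms] by (simp add: g_def comp_def case_prod_unfold)
  then show ?thesis
    unfolding g_def[symmetric] by (auto simp: bij_betw_def image_comp intro: inj_on_imageI)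
qed

text \<open>Old and new lengths fill adjacent, hence disjoint, intervals, so the two bijections
  combine.\<close>

lemma bij_add_new_edges:
  assumes "bij_betw source (edges n 2) (inv_prefix ` interval n 2)"
    and "bij_betw source (edges n i) (inv_prefix ` {bound k..<bound (n + 2 * d)})"
    and "k \<le> n + 2 * d"
    and "edges (Suc n) j = edges n i \<union> (\<lambda>(x, y). (Mid x y, t x y)) ` edges n 2"
  shows "bij_betw source (edges (Suc n) j) (inv_prefix ` {bound k..<bound (Suc (n + 2 * d))})"
proof -
  have "{bound k..<bound (Suc (n + 2 * d))} = {bound k..<bound (n + 2 * d)} \<union> new_interval n"
    using bound_mono[OF assms(3)] bound_Suc[of "n + 2 * d"] by auto
  then show ?thesis
    unfolding assms(4) image_Un
    using bij_betw_combine[OF assms(2) bij_new_edges[OF assms(1), of t]]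
      image_Int[OF inj_inv_prefix, symmetric]
    by (simp add: ivl_disj_int image_Un)
qed

text \<open>This is \<open>tau\<close> read backwards: a unique old colour, never 2, is recoloured
  to \<open>j\<close>.\<close>

lemma edges_Suc:
  assumes "j \<ge> 1"
  shows "edges (Suc n) j =
    edges n (if j = 1 then d + 1 else if j = d then 1 else Suc j) \<union>
    {(Mid x y, b) | x y b. (x, y) \<in> edges n 2 \<and>
      (b = x \<and> j = d \<or> b = y \<and> j = 1 \<or> (\<exists>h\<in>{1..d-2}. b = Tip h x y \<and> j = d + h))}"
    (is "_ = edges n ?k \<union> ?N")
proof -
  have old: "k \<noteq> 2 \<and> j = (if k = 1 then d else if k = d + 1 then 1 else k - 1) \<longleftrightarrow> k = ?k"
    if "k \<noteq> 0" for k
    using assms d3 that by (cases "k = 1"; cases "k = d + 1") auto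
  have "(a, b) \<in> edges (Suc n) j \<longleftrightarrow> (a, b) \<in> edges n ?k \<union> ?N" for a b
  proof
    assume "(a, b) \<in> edges (Suc n) j"
    then have "(a, b, j) \<in> tau d (tree d n)" by (simp add: edges_def tree_Suc)
    then show "(a, b) \<in> edges n ?k \<union> ?N"
    proof (cases rule: mem_tauE)
      case k: (old k)
      then have "k = ?k" using old[of k] colour_ge_1[OF k(1)] by linarith
      then show ?thesis using k(1) unfolding edges_def by blast
    next
      case (mid x y)
      then show ?thesis unfolding edges_def by blast
    qed
  next
    assume "(a, b) \<in> edges n ?k \<union> ?N"
    then show "(a, b) \<in> edges (Suc n) j"
    proof
      assume "(a, b) \<in> edges n ?k"
      moreover have "?k \<noteq> 0" by simp
      ultimately show ?thesis
        unfolding edges_def tree_Suc mem_Collect_eq prod.case mem_tau using old[of ?k] by blast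
    next
      assume "(a, b) \<in> ?N"
      then show ?thesis
        unfolding edges_def tree_Suc mem_Collect_eq prod.case mem_tau by blast
    qed
  qed
  then show ?thesis unfolding set_eq_iff split_paired_All by blast
qed

text \<open>All colours are treated at once, since each one is fed by its old colour and possibly by
  colour 2. Those beyond \<open>2 * d - 2\<close> are included so that the top colour has an old
  colour too.\<close>

lemma bij_source:
  "i \<ge> 1 \<Longrightarrow> bij_betw source (edges n i) (inv_prefix ` interval n i)"
proof (induction n arbitrary: i)
  case 0
  show ?case
  proof (cases "i \<le> d")
    case True
    \<comment> \<open>At level 0 all edges start at the root, of length 0, so the interval must be
      \<open>{0}\<close> for colours up to \<open>d\<close> and empty above.\<close>
    have bound_1: "bound k = 1" if "d + 2 \<le> k" "k \<le> 2 * d" for k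
      using that bound_mono[of k "2 * d"] bound_2d by (simp add: bound_def)
    have "edges 0 i = {(Base 0, Base i)}"
      using True 0 by (auto simp: edges_def tree_0 tree0_def)
    moreover have "interval 0 i = {0}"
      using True 0 d3 bound_1[of "d + i"] bound_2d by (auto simp: interval_def bound_def)
    ultimately show ?thesis using inv_prefix_0 by (simp add: bij_betw_def)
  next
    case False
    then have "bound (Suc i) \<ge> 1" by (simp add: bound_def)
    then have "interval 0 i = {}" using False d3 bound_2d by (auto simp: interval_def)
    moreover have "edges 0 i = {}" using False by (auto simp: edges_def tree_0 tree0_def)
    ultimately show ?thesis by (simp add: bij_betw_def)
  qed
next
  case (Suc n)
  have "bij_betw source (edges n 2) (inv_prefix ` interval n 2)" by (rule Suc.IH) simp
  note new = bij_add_new_edges[OF this]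
  note [simp] = interval_def
  consider "i = 1" | "2 \<le> i" "i < d" | "i = d" | "d < i" "i \<le> 2 * d - 2" | "2 * d - 2 < i"
    using Suc.prems by linarith
  then show ?case
  proof cases
    case 1
    have "edges (Suc n) 1 = edges n (d + 1) \<union> (\<lambda>(x, y). (Mid x y, y)) ` edges n 2"
      using d3 by (subst edges_Suc) (auto simp: image_iff)
    from new[OF _ _ this, of "n + d + 2"] show ?thesis
      using Suc.IH[of "d + 1"] d3 1 by simp
  next
    case 2
    then have "edges (Suc n) i = edges n (Suc i)" by (subst edges_Suc) auto
    then show ?thesis using Suc.IH[of "Suc i"] 2 by simp
  next
    case 3
    have "edges (Suc n) d = edges n 1 \<union> (\<lambda>(x, y). (Mid x y, x)) ` edges n 2"
      using d3 by (subst edges_Suc) (auto simp: image_iff)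
    from new[OF _ _ this, of "n + d + 1"] show ?thesis
      using Suc.IH[of 1] d3 3 by (simp add: mult_2 add.assoc)
  next
    case 4
    have "edges (Suc n) i = edges n (Suc i) \<union> (\<lambda>(x, y). (Mid x y, Tip (i - d) x y)) ` edges n 2"
      using d3 4 by (subst edges_Suc) (auto simp: image_iff)
    from new[OF _ _ this, of "n + i + 2"] show ?thesis
      using Suc.IH[of "Suc i"] d3 4 by simp
  next
    case 5
    then have "edges (Suc n) i = edges n (Suc i)" using d3 by (subst edges_Suc) auto
    \<comment> \<open>Lower ends are at least the upper ends, so the intervals are empty at both
      levels.\<close>
    moreover have "bound (n + 2 * d) \<le> bound (Suc (Suc (n + i)))"
      "bound (Suc (n + 2 * d)) \<le> bound (Suc (Suc (n + i)))"
      using 5 d3 by (auto intro!: bound_mono)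
    moreover have "i > d" "i > 1" using 5 d3 by auto
    ultimately show ?thesis using Suc.IH[of "Suc i"] by simp
  qed
qed

section \<open>Branch vertices\<close>

definition sources :: "nat \<Rightarrow> vertex set" where
  "sources n = insert (Base 0) (\<Union>k<n. (\<lambda>(x, y). Mid x y) ` edges k 2)"

text \<open>Each level appends the block of lengths following those attained so far, so these always
  form an initial segment.\<close>

lemma bij_sources: "bij_betw potential (sources n) (inv_prefix ` {..<bound (n + 2 * d)})"
proof (induction n)
  case 0
  then show ?case by (simp add: sources_def bound_2d inv_prefix_0 bij_betw_def lessThan_Suc)
next
  case (Suc n)
  define g where "g = (\<lambda>(x, y). Mid x y)"
  have "bij_betw (potential \<circ> g) (edges n 2) (inv_prefix ` new_interval n)"
    using bij_new_vertices[OF bij_source[of 2]] by (simp add: g_def comp_def case_prod_unfold)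
  then have "bij_betw potential (g ` edges n 2) (inv_prefix ` new_interval n)"
    by (auto simp: bij_betw_def image_comp intro: inj_on_imageI)
  from bij_betw_combine[OF Suc this]
  have "bij_betw potential (sources n \<union> g ` edges n 2)
      (inv_prefix ` ({..<bound (n + 2 * d)} \<union> new_interval n))"
    by (simp add: image_Un image_Int[OF inj_inv_prefix, symmetric] ivl_disj_int)
  moreover have "sources (Suc n) = sources n \<union> g ` edges n 2"
    by (auto simp: sources_def g_def lessThan_Suc)
  moreover have "{..<bound (n + 2 * d)} \<union> new_interval n = {..<bound (Suc n + 2 * d)}"
    using bound_Suc[of "n + 2 * d"] by auto
  ultimately show ?case by simp
qed

lemma bij_Union_sources: "bij_betw potential (\<Union>n. sources n) (inv_prefixes d)"
proof -
  have "sources n \<subseteq> sources m" if "n \<le> m" for n m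
    unfolding sources_def using that by (intro insert_mono UN_mono) auto
  then have "sources n \<subseteq> sources m \<or> sources m \<subseteq> sources n" for n m
    by (meson nat_le_linear)
  then have "bij_betw potential (\<Union>n. sources n) (\<Union>n. inv_prefix ` {..<bound (n + 2 * d)})"
    by (intro bij_betw_UNION_chain bij_sources) auto
  moreover have "(\<Union>n. {..<bound (n + 2 * d)}) = UNIV" using bound_gt by auto
  then have "(\<Union>n. inv_prefix ` {..<bound (n + 2 * d)}) = inv_prefixes d"
    by (simp add: image_UN[symmetric] range_inv_prefix)
  ultimately show ?thesis by simp
qed

lemma mid_in_tree_vertices:
  assumes "Mid x y \<in> tree_vertices d n"
  shows "\<exists>k<n. (x, y, 2) \<in> tree d k"
  using assms
proof (induction n)
  case 0
  then show ?case by (auto simp: tree_vertices_def tree_0 tree0_def vertices_def)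
next
  case (Suc n)
  then have "Mid x y \<in> vertices (tau d (tree d n))" by (simp add: tree_vertices_def tree_Suc)
  then show ?case
    by (cases rule: vertices_tauE) (use Suc.IH in \<open>auto simp: tree_vertices_def less_Suc_eq\<close>)
qed

section \<open>Degrees of leaves and branch vertices\<close>

definition leaf :: "vertex \<Rightarrow> bool" where
  "leaf v \<longleftrightarrow> v \<noteq> Base 0 \<and> (\<forall>x y. v \<noteq> Mid x y)"

lemma source_not_leaf: "(x, y, i) \<in> tree d n \<Longrightarrow> \<not> leaf x"
proof (induction n arbitrary: x y i)
  case 0
  then show ?case by (auto simp: tree_0 tree0_def leaf_def)
next
  case (Suc n)
  from Suc.prems[unfolded tree_Suc] show ?case
    by (cases rule: mem_tauE) (use Suc.IH in \<open>auto simp: leaf_def\<close>)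
qed

text \<open>The edge entering a leaf either descends from the one entering it a level earlier or
  creates it as a tip.\<close>

lemma leaf_edge_unique:
  "leaf v \<Longrightarrow> (x, v, i) \<in> tree d n \<Longrightarrow> (x', v, i') \<in> tree d n \<Longrightarrow> x = x' \<and> i = i'"
proof (induction n arbitrary: x x' i i')
  case 0
  then show ?case by (auto simp: tree_0 tree0_def)
next
  case (Suc n)
  \<comment> \<open>What becomes of the edge \<open>(a, v, k)\<close> one level later: if it is
    subdivided, only its half of colour 1 ends at \<open>v\<close>.\<close>
  define g where "g a k = (if k = 2 then (Mid a v, 1)
      else (a, if k = 1 then d else if k = d + 1 then 1 else k - 1))" for a k
  have edge: "if v \<in> tree_vertices d n then \<exists>a k. (a, v, k) \<in> tree d n \<and> (b, j) = g a k
      else \<exists>h x y. v = Tip h x y \<and> b = Mid x y \<and> j = d + h"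
    if "(b, v, j) \<in> tree d (Suc n)" for b j
    using that[unfolded tree_Suc]
  proof (cases rule: mem_tauE)
    case (old k)
    then have "v \<in> tree_vertices d n" by (auto simp: tree_vertices_def dest: vertices_edge)
    moreover have "(b, j) = g b k" using old by (simp add: g_def)
    ultimately show ?thesis using old(1) by auto
  next
    case (mid x y)
    have "v \<noteq> x" using source_not_leaf[OF mid(1)] Suc.prems(1) by blast
    then consider "v = y" "j = 1" | h where "v = Tip h x y" "j = d + h" using mid(3) by blast
    then show ?thesis
    proof cases
      case 1
      then have "v \<in> tree_vertices d n"
        using vertices_edge[OF mid(1)] by (simp add: tree_vertices_def)
      moreover have "(b, j) = g x 2" using 1 mid(2) by (simp add: g_def)
      ultimately show ?thesis using mid(1) 1 by auto
    next
      case 2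
      then show ?thesis using new_vertices_fresh(2)[OF mid(1)] mid(2) by simp
    qed
  qed
  show ?case
  proof (cases "v \<in> tree_vertices d n")
    case True
    obtain a k a' k' where "(a, v, k) \<in> tree d n" "(x, i) = g a k"
      "(a', v, k') \<in> tree d n" "(x', i') = g a' k'"
      using edge[OF Suc.prems(2)] edge[OF Suc.prems(3)] True by auto
    moreover from this have "a = a' \<and> k = k'" using Suc.IH[OF Suc.prems(1)] by blast
    ultimately have "(x, i) = (x', i')" by simp
    then show ?thesis by simp
  next
    case False
    then show ?thesis using edge[OF Suc.prems(2)] edge[OF Suc.prems(3)] by auto
  qed
qed

lemma degree_leaf:
  assumes "leaf v"
  shows "degree (tree d n) v \<le> 1"
proof -
  have *: "y = v" if "(x, y, i) \<in> tree d n" "x = v \<or> y = v" for x y i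
    using that source_not_leaf[OF that(1)] assms by auto
  have "a = b" if a: "a \<in> {(x, y, i). (x, y, i) \<in> tree d n \<and> (x = v \<or> y = v)}"
    and b: "b \<in> {(x, y, i). (x, y, i) \<in> tree d n \<and> (x = v \<or> y = v)}" for a b
  proof -
    obtain x y i where 1: "a = (x, y, i)" by (cases a)
    obtain x' y' i' where 2: "b = (x', y', i')" by (cases b)
    have e: "(x, y, i) \<in> tree d n" "x = v \<or> y = v" "(x', y', i') \<in> tree d n" "x' = v \<or> y' = v"
      using a b by (simp_all add: 1 2)
    have y: "y = v" "y' = v" using *[OF e(1,2)] *[OF e(3,4)] .
    show ?thesis using leaf_edge_unique[OF assms, of x i n x' i'] e(1,3) by (simp add: 1 2 y)
  qed
  then have "card E \<le> Suc 0" if "E = {(x, y, i). (x, y, i) \<in> tree d n \<and> (x = v \<or> y = v)}" for E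
    \<comment> \<open>An infinite set has \<open>card\<close> 0, so finiteness of the tree need not
      be known.\<close>
    unfolding that by (cases "finite E") (auto simp: card_le_Suc0_iff_eq that)
  then show ?thesis by (simp add: degree_def)
qed

lemma degree_Base_0: "degree (tree d 0) (Base 0) = d"
proof -
  have "{(x, y, i). (x, y, i) \<in> tree d 0 \<and> (x = Base 0 \<or> y = Base 0)} =
      (\<lambda>j. (Base 0, Base j, j)) ` {1..d}"
    by (auto simp: tree_0 tree0_def)
  then show ?thesis by (simp add: degree_def card_image inj_on_def)
qed

lemma degree_Mid:
  assumes "(x, y, 2) \<in> tree d n"
  shows "degree (tree d (Suc n)) (Mid x y) = d"
proof -
  have fresh: "(Mid x y, b, j) \<notin> tree d n" "(a, Mid x y, j) \<notin> tree d n" for a b j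
    using new_vertices_fresh(1)[OF assms] by (auto simp: tree_vertices_def dest: vertices_edge)
  have xy: "x \<in> tree_vertices d n" "y \<in> tree_vertices d n" if "(x, y, 2) \<in> tree d n" for x y
    using vertices_edge[OF that] by (simp_all add: tree_vertices_def)
  \<comment> \<open>The edges at the new vertex are indexed by their colours 1, d, ..., 2d - 2,
    which are d in number.\<close>
  define target where "target j = (if j = 1 then y else if j = d then x else Tip (j - d) x y)" for j
  have "{(a, b, j). (a, b, j) \<in> tree d (Suc n) \<and> (a = Mid x y \<or> b = Mid x y)} =
      (\<lambda>j. (Mid x y, target j, j)) ` insert 1 {d..2 * d - 2}"
    (is "?A = ?B")
  proof
    show "?A \<subseteq> ?B"
    proof clarify
      fix a b j assume e: "(a, b, j) \<in> tree d (Suc n)" "a = Mid x y \<or> b = Mid x y"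
      from e(1)[unfolded tree_Suc] show "(a, b, j) \<in> ?B"
      proof (cases rule: mem_tauE)
        case (old k)
        then show ?thesis using e(2) fresh by auto
      next
        case (mid x' y')
        then have "a = Mid x y"
          using e(2) xy[OF mid(1)] new_vertices_fresh(1)[OF assms] by auto
        then show ?thesis using mid(2,3) d3 by (auto simp: image_iff target_def)
      qed
    qed
    have "(Mid x y, target j, j) \<in> tree d (Suc n)" if j: "j \<in> insert 1 {d..2 * d - 2}" for j
    proof -
      consider "j = 1" | "j = d" | h where "h \<in> {1..d - 2}" "j = d + h"
      proof (cases "j \<le> d")
        case False
        then have "j - d \<in> {1..d - 2}" "j = d + (j - d)" using j d3 by auto
        then show ?thesis by (rule that(3))
      qed (use j that in auto)
      then show ?thesis
        unfolding tree_Suc mem_tau using assms d3 by cases (auto simp: target_def)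
    qed
    then show "?B \<subseteq> ?A" by blast
  qed
  moreover have "card ((\<lambda>j. (Mid x y, target j, j)) ` insert 1 {d..2 * d - 2}) =
      card (insert 1 {d..2 * d - 2})"
    by (rule card_image) (simp add: inj_on_def)
  moreover have "card (insert 1 {d..2 * d - 2}) = d" using d3 by simp
  ultimately show ?thesis by (simp only: degree_def)
qed

text \<open>As d > 1, a vertex of degree d is the root or a midpoint; conversely these have degree d
  at the level where they appear, which suffices for the union.\<close>

lemma Union_branch_vertices: "(\<Union>n. branch_vertices d n) = (\<Union>n. sources n)"
proof
  show "(\<Union>n. branch_vertices d n) \<subseteq> (\<Union>n. sources n)"
  proof clarify
    fix v n assume v: "v \<in> branch_vertices d n"
    then have "\<not> leaf v" using degree_leaf[of v n] d3 by (auto simp: branch_vertices_def)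
    then consider "v = Base 0" | x y where "v = Mid x y" by (auto simp: leaf_def)
    then show "v \<in> (\<Union>n. sources n)"
    proof cases
      case (2 x y)
      then have "\<exists>k<n. (x, y, 2) \<in> tree d k"
        using v mid_in_tree_vertices by (simp add: branch_vertices_def)
      with 2 show ?thesis by (force simp: sources_def edges_def)
    qed (simp add: sources_def)
  qed
next
  have "Base 0 \<in> branch_vertices d 0"
  proof -
    have "(Base 0, Base 1, 1) \<in> tree d 0" using d3 by (auto simp: tree_0 tree0_def)
    then show ?thesis
      using vertices_edge degree_Base_0 by (auto simp: branch_vertices_def tree_vertices_def)
  qed
  moreover have "Mid x y \<in> branch_vertices d (Suc k)" if "(x, y, 2) \<in> tree d k" for x y k
  proof -
    have "(Mid x y, y, 1) \<in> tree d (Suc k)" using that by (auto simp: tree_Suc mem_tau)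
    then show ?thesis
      using vertices_edge degree_Mid[OF that] by (auto simp: branch_vertices_def tree_vertices_def)
  qed
  ultimately show "(\<Union>n. sources n) \<subseteq> (\<Union>n. branch_vertices d n)"
    by (auto simp: sources_def edges_def)
qed

lemma bij_f0: "bij_betw (f0 d) (\<Union>n. branch_vertices d n) (inv_prefixes d)"
proof (rule bij_betw_cong[THEN iffD2])
  show "bij_betw potential (\<Union>n. branch_vertices d n) (inv_prefixes d)"
    unfolding Union_branch_vertices by (rule bij_Union_sources)
qed (auto simp: branch_vertices_def intro: f0_eq_potential)

end

theorem proposition3p17:
  fixes d :: nat
  assumes "d \<ge> 3"
  shows "bij_betw (f0 d) (\<Union>n. branch_vertices d n) (inv_prefixes d)"
  using assms by (rule bij_f0)

end
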